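(* Let $n\ge 1$ be an integer. The commuting graph $\Delta(SD_{8n})$ is Hamiltonian if and only if $n\in\{1,3\}$.
   Context: For an integer $n\ge 1$, $SD_{8n}=\langle a,b : a^{4n}=b^2=e,\ ba=a^{2n-1}b\rangle$, a group of order $8n$. The commuting graph $\Delta(G)$ of a group $G$ is the simple graph with vertex set $G$ in which two distinct vertices $x,y$ are adjacent iff $xy=yx$. A graph is Hamiltonian if it has a cycle passing through every vertex. *)

theory Defs
  imports "HOL-Algebra.Group" "Graph_Theory.Pair_Digraph"
begin

text \<open>Group presentations. A word is a list of letters, where \<open>(x, True)\<close> stands for the
  generator \<open>x\<close> and \<open>(x, False)\<close> for its inverse; every element of the type \<open>'x\<close> is a
  generator. A pair \<open>(u, v) \<in> R\<close> is the defining relation \<open>u = v\<close>.\<close>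

type_synonym 'x gword = "('x \<times> bool) list"

inductive word_eq :: "('x gword \<times> 'x gword) set \<Rightarrow> 'x gword \<Rightarrow> 'x gword \<Rightarrow> bool"
  for R where
  refl: "word_eq R u u"
| sym: "word_eq R u v \<Longrightarrow> word_eq R v u"
| trans: "word_eq R u v \<Longrightarrow> word_eq R v w \<Longrightarrow> word_eq R u w"
| append: "word_eq R u u' \<Longrightarrow> word_eq R v v' \<Longrightarrow> word_eq R (u @ v) (u' @ v')"
| cancel: "word_eq R [(x, s), (x, \<not> s)] []"
| relation: "(u, v) \<in> R \<Longrightarrow> word_eq R u v"

definition word_class :: "('x gword \<times> 'x gword) set \<Rightarrow> 'x gword \<Rightarrow> 'x gword set" where
  "word_class R u = {v. word_eq R u v}"

definition presented_group :: "('x gword \<times> 'x gword) set \<Rightarrow> 'x gword set monoid" where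
  "presented_group R =
    \<lparr>carrier = range (word_class R),
     monoid.mult = (\<lambda>X Y. {w. \<exists>u\<in>X. \<exists>v\<in>Y. word_eq R (u @ v) w}),
     one = word_class R []\<rparr>"

lemma word_class_eq_iff: "word_class R u = word_class R v \<longleftrightarrow> word_eq R u v"
  unfolding word_class_def by (auto intro: word_eq.intros)

lemma mult_word_class:
  "word_class R u \<otimes>\<^bsub>presented_group R\<^esub> word_class R v = word_class R (u @ v)"
  unfolding presented_group_def word_class_def
  by (auto intro: word_eq.intros)

definition inverse_word :: "'x gword \<Rightarrow> 'x gword" where
  "inverse_word u = rev (map (\<lambda>(x, s). (x, \<not> s)) u)"

lemma word_eq_inverse: "word_eq R (inverse_word u @ u) []"
proof (induction u)
  case Nil
  show ?case by (simp add: inverse_word_def word_eq.refl)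
next
  case (Cons l u)
  obtain x s where l: "l = (x, s)" by (cases l)
  have "word_eq R [(x, \<not> s), (x, s)] []"
    using word_eq.cancel[of R x "\<not> s"] by simp
  then have "word_eq R (inverse_word u @ [(x, \<not> s), (x, s)] @ u) (inverse_word u @ [] @ u)"
    by (intro word_eq.append word_eq.refl)
  then show ?case
    using Cons.IH l by (auto simp: inverse_word_def intro: word_eq.trans)
qed

lemma group_presented_group: "group (presented_group R)"
proof (rule groupI)
  have carrier: "carrier (presented_group R) = range (word_class R)"
    and one: "\<one>\<^bsub>presented_group R\<^esub> = word_class R []"
    by (simp_all add: presented_group_def)
  note facts = carrier one mult_word_class
  show "\<one>\<^bsub>presented_group R\<^esub> \<in> carrier (presented_group R)"
    by (auto simp: facts)
  fix x assume "x \<in> carrier (presented_group R)"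
  then obtain u where x: "x = word_class R u" by (auto simp: facts)
  show "\<one>\<^bsub>presented_group R\<^esub> \<otimes>\<^bsub>presented_group R\<^esub> x = x"
    by (simp add: facts x)
  show "\<exists>y\<in>carrier (presented_group R). y \<otimes>\<^bsub>presented_group R\<^esub> x = \<one>\<^bsub>presented_group R\<^esub>"
    by (auto simp: facts x word_class_eq_iff intro: word_eq_inverse)
  fix y assume "y \<in> carrier (presented_group R)"
  then obtain v where y: "y = word_class R v" by (auto simp: facts)
  show "x \<otimes>\<^bsub>presented_group R\<^esub> y \<in> carrier (presented_group R)"
    by (auto simp: facts x y)
  fix z assume "z \<in> carrier (presented_group R)"
  then show "x \<otimes>\<^bsub>presented_group R\<^esub> y \<otimes>\<^bsub>presented_group R\<^esub> z =
      x \<otimes>\<^bsub>presented_group R\<^esub> (y \<otimes>\<^bsub>presented_group R\<^esub> z)"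
    by (auto simp: facts x y)
qed

text \<open>The universal property: generators of any group satisfying the relations induce a
  homomorphism.\<close>

primrec eval_word :: "('g, 'm) monoid_scheme \<Rightarrow> ('x \<Rightarrow> 'g) \<Rightarrow> 'x gword \<Rightarrow> 'g" where
  "eval_word H f [] = \<one>\<^bsub>H\<^esub>"
| "eval_word H f (l # u) =
    (if snd l then f (fst l) else inv\<^bsub>H\<^esub> f (fst l)) \<otimes>\<^bsub>H\<^esub> eval_word H f u"

lemma presented_group_universal:
  assumes "group H" and f: "\<And>x. f x \<in> carrier H"
    and rel: "\<And>u v. (u, v) \<in> R \<Longrightarrow> eval_word H f u = eval_word H f v"
  shows "\<exists>h \<in> hom (presented_group R) H. \<forall>u. h (word_class R u) = eval_word H f u"
proof -
  interpret H: group H by fact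
  have closed: "eval_word H f u \<in> carrier H" for u
    by (induction u) (auto simp: f)
  have app: "eval_word H f (u @ v) = eval_word H f u \<otimes>\<^bsub>H\<^esub> eval_word H f v" for u v
    by (induction u) (auto simp: f closed H.m_assoc)
  have sound: "word_eq R u v \<Longrightarrow> eval_word H f u = eval_word H f v" for u v
    by (induction rule: word_eq.induct) (auto simp: app f rel)
  define h where "h X = eval_word H f (SOME u. u \<in> X)" for X
  have h: "h (word_class R u) = eval_word H f u" for u
  proof -
    have "(SOME v. v \<in> word_class R u) \<in> word_class R u"
      by (rule someI[of _ u]) (simp add: word_class_def word_eq.refl)
    then show ?thesis
      using sound by (auto simp: h_def word_class_def)
  qed
  have "h \<in> hom (presented_group R) H"
  proof (rule homI)
    have carrier: "carrier (presented_group R) = range (word_class R)"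
      by (simp add: presented_group_def)
    fix X Y assume "X \<in> carrier (presented_group R)" "Y \<in> carrier (presented_group R)"
    then show "h (X \<otimes>\<^bsub>presented_group R\<^esub> Y) = h X \<otimes>\<^bsub>H\<^esub> h Y"
      by (auto simp: carrier h mult_word_class app)
  qed (auto simp: presented_group_def h closed)
  then show ?thesis using h by blast
qed

text \<open>The group of order \<open>8 * n\<close>, with \<open>n \<ge> 1\<close>; for \<open>n = 0\<close> the exponent \<open>2 * n - 1\<close> would be
  truncated.\<close>

datatype SD_gen = SD_a | SD_b

definition SD_group :: "nat \<Rightarrow> SD_gen gword set monoid" where
  "SD_group n = (let a = (SD_a, True); b = (SD_b, True) in
    presented_group
      {(replicate (4 * n) a, []),
       (replicate 2 b, []),
       ([b, a], replicate (2 * n - 1) a @ [b])})"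

text \<open>A simple graph is represented as a symmetric loop-free digraph.\<close>

definition commuting_graph :: "('g, 'm) monoid_scheme \<Rightarrow> 'g pair_pre_digraph" where
  "commuting_graph G =
    \<lparr>pverts = carrier G,
     parcs = {(x, y). x \<in> carrier G \<and> y \<in> carrier G \<and> x \<noteq> y \<and> x \<otimes>\<^bsub>G\<^esub> y = y \<otimes>\<^bsub>G\<^esub> x}\<rparr>"

text \<open>In a symmetric digraph the closed walk \<open>x, y, x\<close> counts as a cycle for
  \<^const>\<open>pre_digraph.cycle\<close>, but it is not a cycle of the undirected graph; hence the bound
  on the length. The vertices on a cycle are the tails of its arcs.\<close>

definition hamiltonian :: "'v pair_pre_digraph \<Rightarrow> bool" where
  "hamiltonian G \<longleftrightarrow>
    (\<exists>p. pre_digraph.cycle (with_proj G) p \<and> 3 \<le> length p \<and> fst ` set p = pverts G)"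

end

theory Submission
  imports Defs
begin

text \<open>For \<open>n \<ge> 2\<close> let \<open>m = 2 n\<close> if \<open>n\<close> is even and \<open>m = n\<close> otherwise. The center consists of the
  \<open>4 n / m\<close> powers of \<open>a\<^sup>m\<close>, and deleting it from the commuting graph leaves \<open>m + 1\<close> components: the
  rest of the cyclic group generated by \<open>a\<close>, and the \<open>m\<close> cosets of the center outside that group,
  all of them cliques. A Hamiltonian cycle needs at least as many central vertices as there are
  components, so \<open>m + 1 \<le> 4 n / m\<close>, which forces \<open>n = 3\<close>; then both sides are \<open>4\<close> and a cycle
  through the four cliques exists. For \<open>n = 1\<close> the group is abelian and the graph complete.\<close>

section \<open>Hamiltonian cycles as cyclic vertex lists, and a counting obstruction\<close>

text \<open>Unfolds the recursive \<open>cas\<close> into conditions at indices, so that an arc list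
  can be compared entrywise with \<open>zip vs (rotate1 vs)\<close>.\<close>

lemma (in pre_digraph) cas_conv_nth:
  assumes "p \<noteq> []"
  shows "cas u p v \<longleftrightarrow> tail G (p ! 0) = u \<and> head G (last p) = v \<and>
    (\<forall>i. Suc i < length p \<longrightarrow> head G (p ! i) = tail G (p ! Suc i))"
  using assms
proof (induction p arbitrary: u)
  case (Cons e p)
  show ?case
  proof (cases "p = []")
    case False
    then show ?thesis
      using Cons.IH[of "head G e"] by (auto simp: nth_Cons split: nat.splits)
  qed simp
qed simp

text \<open>A closed walk is determined by the tails of its arcs, the arcs being the pairs of
  cyclically consecutive tails. In this form a cycle can be mapped along a bijection or checked by
  evaluation.\<close>

lemma hamiltonian_iff_list:
  "hamiltonian G \<longleftrightarrow>
    (\<exists>vs. distinct vs \<and> 3 \<le> length vs \<and> set vs = pverts G \<and>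
      set (zip vs (rotate1 vs)) \<subseteq> parcs G)"
    (is "_ \<longleftrightarrow> (\<exists>vs. ?P vs)")
proof
  assume "hamiltonian G"
  then obtain p u where p: "3 \<le> length p" "fst ` set p = pverts G"
    and walk: "pre_digraph.awalk (with_proj G) u p u"
    and dist: "distinct (tl (pre_digraph.awalk_verts (with_proj G) u p))"
    unfolding hamiltonian_def pre_digraph.cycle_def by blast
  have ne: "p \<noteq> []" using p by auto
  have cas: "pre_digraph.cas (with_proj G) u p u" and arcs: "set p \<subseteq> parcs G"
    using walk by (auto simp: pre_digraph.awalk_def)
  have nth: "fst (p ! 0) = u" "snd (last p) = u"
    "\<And>i. Suc i < length p \<Longrightarrow> snd (p ! i) = fst (p ! Suc i)"
    using cas by (auto simp: pre_digraph.cas_conv_nth[OF ne])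
  \<comment> \<open>The vertex list of a closed walk repeats \<open>u\<close> at its end, so
    dropping its first entry leaves a rotation of the tails.\<close>
  have "tl (pre_digraph.awalk_verts (with_proj G) u p) = tl (map fst p) @ [u]"
    using ne nth(2) by (simp add: pre_digraph.awalk_verts_conv)
  also have "\<dots> = rotate1 (map fst p)"
    using ne nth(1) by (cases p) auto
  finally have "distinct (map fst p)"
    using dist by simp
  moreover have "p = zip (map fst p) (rotate1 (map fst p))"
  proof (rule nth_equalityI)
    fix i assume i: "i < length p"
    show "p ! i = zip (map fst p) (rotate1 (map fst p)) ! i"
    proof (cases "Suc i < length p")
      case True
      then show ?thesis using i nth(3)[of i]
        by (simp add: nth_rotate1 prod_eq_iff)
    next
      case False
      then have "Suc i = length p" using i by simp
      then show ?thesis using i nth(1,2) ne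
        by (simp add: nth_rotate1 prod_eq_iff last_conv_nth flip: \<open>Suc i = length p\<close>)
    qed
  qed simp
  ultimately have "?P (map fst p)"
    using p arcs by simp
  then show "\<exists>vs. ?P vs" ..
next
  assume "\<exists>vs. ?P vs"
  then obtain vs where vs: "?P vs" by blast
  define p where "p = zip vs (rotate1 vs)"
  have len: "length p = length vs" by (simp add: p_def)
  have ne: "p \<noteq> []" "vs \<noteq> []" using vs len by auto
  have tails: "map fst p = vs" by (simp add: p_def)
  have cas: "pre_digraph.cas (with_proj G) (hd vs) p (hd vs)"
    unfolding pre_digraph.cas_conv_nth[OF ne(1)]
    using ne by (auto simp: p_def last_conv_nth nth_rotate1 hd_conv_nth)
  have "pre_digraph.awalk_verts (with_proj G) (hd vs) p = vs @ [hd vs]"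
    using tails ne cas by (simp add: pre_digraph.awalk_verts_conv pre_digraph.cas_conv_nth)
  then have "tl (pre_digraph.awalk_verts (with_proj G) (hd vs) p) = rotate1 vs"
    using ne by (cases vs) auto
  moreover have "fst ` set p = pverts G"
    using vs tails by (metis set_map)
  moreover have "hd vs \<in> pverts G" using vs ne by auto
  ultimately show "hamiltonian G"
    using vs cas len ne unfolding hamiltonian_def pre_digraph.cycle_def
    by (intro exI[of _ p] conjI exI[of _ "hd vs"]) (simp_all add: pre_digraph.awalk_def flip: p_def)
qed

text \<open>Leaving a class of \<open>c\<close> along a Hamiltonian cycle, one must enter \<open>Z\<close>, and distinct
  classes are left into distinct vertices of \<open>Z\<close>.\<close>

lemma hamiltonian_card_classes_le:
  assumes "hamiltonian G" and Z: "finite Z" "Z \<inter> pverts G \<noteq> {}"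
    and c: "\<And>x y. (x, y) \<in> parcs G \<Longrightarrow> x \<notin> Z \<Longrightarrow> y \<notin> Z \<Longrightarrow> c x = c y"
  shows "card (c ` (pverts G - Z)) \<le> card Z"
proof -
  obtain vs where vs: "distinct vs" "3 \<le> length vs" "set vs = pverts G"
      "set (zip vs (rotate1 vs)) \<subseteq> parcs G"
    using assms(1) unfolding hamiltonian_iff_list by blast
  define N where "N = length vs"
  \<comment> \<open>Periodic indexing lets the cycle be followed indefinitely without treating the
    wrap-around separately.\<close>
  define v where "v i = vs ! (i mod N)" for i
  have N: "N > 0" using vs by (auto simp: N_def)
  have arc: "(v i, v (Suc i)) \<in> parcs G" for i
  proof -
    have "zip vs (rotate1 vs) ! (i mod N) \<in> set (zip vs (rotate1 vs))"
      using N by (intro nth_mem) (simp add: N_def)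
    then show ?thesis
      using vs(4) N by (auto simp: v_def N_def nth_rotate1 mod_Suc_eq)
  qed
  have surj: "\<exists>i. v i = x" if "x \<in> pverts G" for x
    using that vs(3) unfolding v_def N_def by (metis in_set_conv_nth mod_less)
  obtain z k where z: "z \<in> Z" "v k = z"
    using Z(2) surj by blast
  have exit: "\<exists>i. v i \<notin> Z \<and> c (v i) = C \<and> v (Suc i) \<in> Z" if C: "C \<in> c ` (pverts G - Z)" for C
  proof (rule ccontr)
    assume no: "\<not> ?thesis"
    obtain j where j: "v j \<notin> Z" "c (v j) = C"
      using C surj by blast
    \<comment> \<open>Without an exit, the walk from \<open>j\<close> would remain in the class
      \<open>C\<close> forever and never meet \<open>z\<close>.\<close>
    have stay: "v (j + d) \<notin> Z \<and> c (v (j + d)) = C" for d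
    proof (induction d)
      case (Suc d)
      then show ?case using no arc[of "j + d"] c by auto
    qed (use j in simp)
    \<comment> \<open>The index \<open>k + N * j\<close> also names \<open>z\<close> and is at least
      \<open>j\<close>, so the natural subtraction below is exact.\<close>
    have "j \<le> N * j" using N by simp
    then have "j + (k + N * j - j) = k + N * j" by linarith
    then have "v (j + (k + N * j - j)) = v k"
      by (simp add: v_def)
    then show False using stay[of "k + N * j - j"] z by simp
  qed
  define X where "X C = (SOME i. v i \<notin> Z \<and> c (v i) = C \<and> v (Suc i) \<in> Z)" for C
  have X: "v (X C) \<notin> Z \<and> c (v (X C)) = C \<and> v (Suc (X C)) \<in> Z"
    if "C \<in> c ` (pverts G - Z)" for C
    unfolding X_def by (rule someI_ex[OF exit[OF that]])
  have inj_v: "v i = v j" if "v (Suc i) = v (Suc j)" for i j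
  proof -
    have "Suc i mod N = Suc j mod N"
      using that vs(1) N by (simp add: v_def N_def nth_eq_iff_index_eq)
    \<comment> \<open>Over the integers the successor cancels from the congruence by
      subtraction.\<close>
    then have "int (Suc i) mod int N = int (Suc j) mod int N"
      by (simp only: flip: zmod_int)
    then have "int i mod int N = int j mod int N"
      by (simp add: mod_eq_dvd_iff)
    then have "i mod N = j mod N"
      by (simp flip: zmod_int)
    then show ?thesis by (simp add: v_def)
  qed
  have "inj_on (\<lambda>C. v (Suc (X C))) (c ` (pverts G - Z))"
    by (rule inj_onI) (metis X inj_v)
  moreover have "(\<lambda>C. v (Suc (X C))) ` (c ` (pverts G - Z)) \<subseteq> Z"
    using X by blast
  ultimately show ?thesis
    using Z(1) by (rule card_inj_on_le)
qed

section \<open>Invariance under group isomorphism\<close>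

text \<open>A bijective homomorphism preserves commutation and distinctness, so it maps a cyclic
  list to a cyclic list. The inverse isomorphism gives the converse.\<close>

lemma hamiltonian_commuting_graph_hom_image:
  assumes "hamiltonian (commuting_graph G)" and "h \<in> iso G H"
  shows "hamiltonian (commuting_graph H)"
proof -
  have h: "bij_betw h (carrier G) (carrier H)" "h \<in> hom G H"
    using assms(2) by (auto simp: iso_def)
  obtain vs where vs: "distinct vs" "3 \<le> length vs" "set vs = carrier G"
      "set (zip vs (rotate1 vs)) \<subseteq> parcs (commuting_graph G)"
    using assms(1) unfolding hamiltonian_iff_list by (auto simp: commuting_graph_def)
  have arc: "(h x, h y) \<in> parcs (commuting_graph H)" if "(x, y) \<in> parcs (commuting_graph G)" for x y
    using that h by (auto simp: commuting_graph_def hom_in_carrier bij_betw_def inj_on_eq_iff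
        simp flip: hom_mult[OF h(2)])
  have "set (zip (map h vs) (rotate1 (map h vs))) \<subseteq> parcs (commuting_graph H)"
    using vs(4) arc by (auto simp: rotate1_map zip_map_map)
  then show ?thesis
    unfolding hamiltonian_iff_list using vs h
    by (intro exI[of _ "map h vs"]) (auto simp: distinct_map bij_betw_def commuting_graph_def)
qed

lemma hamiltonian_commuting_graph_iso:
  assumes "group G" and "G \<cong> H"
  shows "hamiltonian (commuting_graph G) \<longleftrightarrow> hamiltonian (commuting_graph H)"
proof -
  obtain h where h: "h \<in> iso G H" using assms(2) by (auto simp: is_iso_def)
  then have "inv_into (carrier G) h \<in> iso H G"
    using assms(1) by (simp add: group.iso_set_sym)
  with h show ?thesis
    by (blast intro: hamiltonian_commuting_graph_hom_image)
qed

section \<open>A concrete model of the group\<close>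

text \<open>The semidirect product of the integers modulo \<open>m\<close> by a group of order two, whose
  generator acts as multiplication by \<open>e\<close>; the pair \<open>(i, s)\<close> is \<open>a\<^sup>i b\<^sup>s\<close>.\<close>

definition semidirect :: "int \<Rightarrow> int \<Rightarrow> (int \<times> bool) monoid" where
  "semidirect m e =
    \<lparr>carrier = {0..<m} \<times> UNIV,
     monoid.mult = (\<lambda>(i, s) (j, t). ((i + (if s then e * j else j)) mod m, s \<noteq> t)),
     one = (0, False)\<rparr>"

lemma semidirect_simps [simp]:
  "carrier (semidirect m e) = {0..<m} \<times> UNIV"
  "(i, s) \<otimes>\<^bsub>semidirect m e\<^esub> (j, t) = ((i + (if s then e * j else j)) mod m, s \<noteq> t)"
  "\<one>\<^bsub>semidirect m e\<^esub> = (0, False)"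
  by (simp_all add: semidirect_def)

text \<open>The hypothesis on \<open>e\<close> says that multiplication by \<open>e\<close> is an
  involution modulo \<open>m\<close>, as an action of a group of order two requires. Associativity
  uses this when \<open>x\<close> and \<open>y\<close> both carry the second generator.\<close>

lemma group_semidirect:
  assumes "m > 0" and e: "m dvd e * e - 1"
  shows "group (semidirect m e)"
proof (rule groupI)
  have ee: "(x + e * (e * y)) mod m = (x + y) mod m" for x y
  proof -
    have "x + e * (e * y) - (x + y) = (e * e - 1) * y" by (simp add: algebra_simps)
    then show ?thesis using e by (simp add: mod_eq_dvd_iff)
  qed
  fix x y z
  assume "x \<in> carrier (semidirect m e)" "y \<in> carrier (semidirect m e)" "z \<in> carrier (semidirect m e)"
  show "x \<otimes>\<^bsub>semidirect m e\<^esub> y \<otimes>\<^bsub>semidirect m e\<^esub> z =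
      x \<otimes>\<^bsub>semidirect m e\<^esub> (y \<otimes>\<^bsub>semidirect m e\<^esub> z)"
  proof (cases x; cases y; cases z)
    fix i s j t k u
    assume [simp]: "x = (i, s)" "y = (j, t)" "z = (k, u)"
    have "(i + e * ((j + w) mod m)) mod m = (i + e * j + e * w) mod m" for w
      by (metis add.assoc distrib_left mod_add_right_eq mod_mult_right_eq)
    then show ?thesis
      using ee[of "i + e * j" k] by (auto simp: mod_simps add.assoc)
  qed
next
  fix x assume "x \<in> carrier (semidirect m e)"
  then obtain i s where x: "x = (i, s)" "0 \<le> i" "i < m" by auto
  show "\<exists>y\<in>carrier (semidirect m e). y \<otimes>\<^bsub>semidirect m e\<^esub> x = \<one>\<^bsub>semidirect m e\<^esub>"
    using x \<open>m > 0\<close>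
    by (intro bexI[of _ "(- (if s then e * i else i) mod m, s)"]) (auto simp: mod_simps)
qed (use \<open>m > 0\<close> in auto)

abbreviation SD_model :: "nat \<Rightarrow> (int \<times> bool) monoid" where
  "SD_model n \<equiv> semidirect (4 * int n) (2 * int n - 1)"

lemma group_SD_model: "n \<ge> 1 \<Longrightarrow> group (SD_model n)"
proof (rule group_semidirect)
  have "(2 * int n - 1) * (2 * int n - 1) - 1 = 4 * int n * (int n - 1)"
    by (simp add: algebra_simps)
  then show "4 * int n dvd (2 * int n - 1) * (2 * int n - 1) - 1" by simp
qed simp


section \<open>Normal forms in the presented group, and its isomorphism with the model\<close>

lemma word_class_in_carrier: "word_class R u \<in> carrier (presented_group R)"
  by (simp add: presented_group_def)

lemma word_class_Nil: "word_class R [] = \<one>\<^bsub>presented_group R\<^esub>"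
  by (simp add: presented_group_def)

lemma word_class_replicate:
  "word_class R (replicate k l) = word_class R [l] [^]\<^bsub>presented_group R\<^esub> k"
proof (induction k)
  case 0
  interpret group "presented_group R" by (rule group_presented_group)
  show ?case by (simp add: word_class_Nil)
next
  case (Suc k)
  interpret group "presented_group R" by (rule group_presented_group)
  have "word_class R (replicate (Suc k) l) = word_class R (replicate k l @ [l])"
    by (simp add: replicate_append_same)
  then show ?case by (simp add: Suc flip: mult_word_class)
qed

lemma word_class_inverse_letter:
  "word_class R [(x, False)] = inv\<^bsub>presented_group R\<^esub> word_class R [(x, True)]"
proof -
  interpret group "presented_group R" by (rule group_presented_group)
  have "word_eq R [(x, False), (x, True)] []"
    using word_eq.cancel[of R x False] by simp
  then have "word_class R [(x, False)] \<otimes>\<^bsub>presented_group R\<^esub> word_class R [(x, True)]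
      = \<one>\<^bsub>presented_group R\<^esub>"
    by (simp add: mult_word_class flip: word_class_Nil word_class_eq_iff)
  then show ?thesis
    by (simp add: word_class_in_carrier inv_equality)
qed

lemma (in group) pow_eq_pow_mod:
  assumes "x \<in> carrier G" and "x [^] (m :: nat) = \<one>"
  shows "x [^] i = x [^] (i mod m)"
proof -
  have "x [^] i = x [^] (m * (i div m) + i mod m)" by simp
  also have "\<dots> = (x [^] m) [^] (i div m) \<otimes> x [^] (i mod m)"
    using assms(1) by (simp only: nat_pow_mult nat_pow_pow)
  finally show ?thesis using assms by simp
qed

text \<open>Moving \<open>y\<close> to the right past each factor \<open>x\<close> turns that factor
  into its \<open>k\<close>-th power. With \<open>k = 2 * n - 1\<close> this moves \<open>B\<close>
  past any power of \<open>A\<close>.\<close>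

lemma (in group) commutation_pow:
  assumes "x \<in> carrier G" "y \<in> carrier G" and "y \<otimes> x = x [^] (k :: nat) \<otimes> y"
  shows "y \<otimes> x [^] (i :: nat) = x [^] (k * i) \<otimes> y"
proof (induction i)
  case (Suc i)
  have "y \<otimes> x [^] Suc i = (y \<otimes> x [^] i) \<otimes> x" using assms by (simp add: m_assoc)
  also have "\<dots> = x [^] (k * i) \<otimes> (y \<otimes> x)" using assms(1,2) by (simp add: Suc m_assoc)
  also have "\<dots> = (x [^] (k * i) \<otimes> x [^] k) \<otimes> y" using assms by (simp add: m_assoc)
  finally show ?case using assms by (simp add: nat_pow_mult add.commute)
qed (use assms in simp)

lemma semidirect_pow:
  assumes "m > 1"
  shows "(1, False) [^]\<^bsub>semidirect m e\<^esub> (k :: nat) = (int k mod m, False)"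
proof (induction k)
  case (Suc k)
  then show ?case by (simp add: nat_pow_def mod_simps add.commute)
qed (simp add: nat_pow_def)

text \<open>The relations bring every word to the form \<open>A\<close> to the \<open>i\<close>
  times \<open>B\<close> or the identity, with \<open>i\<close> relevant only modulo
  \<open>4 * n\<close>. The homomorphism given by the universal property separates these forms, so
  no further collapse occurs.\<close>

lemma SD_group_iso_model:
  assumes "n \<ge> 1"
  shows "group (SD_group n)" and "SD_group n \<cong> SD_model n"
proof -
  define R where "R = {(replicate (4 * n) (SD_a, True), []), (replicate 2 (SD_b, True), []),
       ([(SD_b, True), (SD_a, True)], replicate (2 * n - 1) (SD_a, True) @ [(SD_b, True)])}"
  define G where "G = presented_group R"
  have G_eq: "SD_group n = G" by (simp add: SD_group_def G_def R_def Let_def)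
  interpret G: group G unfolding G_def by (rule group_presented_group)
  interpret H: group "SD_model n" using assms by (rule group_SD_model)
  show "group (SD_group n)" by (simp add: G_eq G.is_group)
  define A where "A = word_class R [(SD_a, True)]"
  define B where "B = word_class R [(SD_b, True)]"
  have AB [simp]: "A \<in> carrier G" "B \<in> carrier G"
    by (simp_all add: A_def B_def G_def word_class_in_carrier)
  have rel: "word_class R u = word_class R v" if "(u, v) \<in> R" for u v
    using that by (simp add: word_class_eq_iff word_eq.relation)
  have A_pow: "A [^]\<^bsub>G\<^esub> (4 * n) = \<one>\<^bsub>G\<^esub>"
    using rel[of "replicate (4 * n) (SD_a, True)" "[]"]
    by (simp add: R_def A_def G_def word_class_replicate flip: word_class_Nil)
  have "word_class R [(SD_b, True), (SD_b, True)] = word_class R []"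
    by (rule rel) (simp add: R_def numeral_2_eq_2)
  then have BB: "B \<otimes>\<^bsub>G\<^esub> B = \<one>\<^bsub>G\<^esub>"
    by (simp add: B_def G_def mult_word_class flip: word_class_Nil)
  have "word_class R [(SD_b, True), (SD_a, True)]
      = word_class R (replicate (2 * n - 1) (SD_a, True) @ [(SD_b, True)])"
    by (rule rel) (simp add: R_def)
  then have "B \<otimes>\<^bsub>G\<^esub> A = A [^]\<^bsub>G\<^esub> (2 * n - 1) \<otimes>\<^bsub>G\<^esub> B"
    by (simp add: A_def B_def G_def mult_word_class flip: word_class_replicate)
  note BA = G.commutation_pow[OF AB this]
  have invB: "inv\<^bsub>G\<^esub> B = B" using BB by (simp add: G.inv_equality)
  \<comment> \<open>Writing the inverse of \<open>A\<close> as a natural power allows normal forms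
    with natural exponents only.\<close>
  have "A [^]\<^bsub>G\<^esub> (4 * n - 1) \<otimes>\<^bsub>G\<^esub> A = A [^]\<^bsub>G\<^esub> Suc (4 * n - 1)" by simp
  then have invA: "inv\<^bsub>G\<^esub> A = A [^]\<^bsub>G\<^esub> (4 * n - 1)"
    using assms A_pow by (intro G.inv_equality) simp_all
  define nf where "nf i s = A [^]\<^bsub>G\<^esub> (i :: nat) \<otimes>\<^bsub>G\<^esub> (if s then B else \<one>\<^bsub>G\<^esub>)" for i s
  have nf_closed [simp]: "nf i s \<in> carrier G" for i s by (simp add: nf_def)
  have A_nf: "A [^]\<^bsub>G\<^esub> (k :: nat) \<otimes>\<^bsub>G\<^esub> nf i s = nf (k + i) s" for k i s
    by (simp add: nf_def G.nat_pow_mult flip: G.m_assoc)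
  have B_nf: "B \<otimes>\<^bsub>G\<^esub> nf i s = nf ((2 * n - 1) * i) (\<not> s)" for i s
    using BA[of i] BB by (simp add: nf_def G.m_assoc flip: G.m_assoc[of B])
  have A1: "A [^]\<^bsub>G\<^esub> (1 :: nat) = A" by simp
  have letter: "word_class R [(SD_a, True)] = A [^]\<^bsub>G\<^esub> (1 :: nat)"
      "word_class R [(SD_a, False)] = A [^]\<^bsub>G\<^esub> (4 * n - 1)"
      "word_class R [(SD_b, b)] = B" for b
    using invA invB A1 word_class_inverse_letter[of R, folded G_def]
    unfolding A_def B_def by (metis (full_types))+
  \<comment> \<open>Normal forms are closed under left multiplication by every letter, inverse
    letters included; this is the induction step for words.\<close>
  have letters: "\<exists>j t. word_class R [l] \<otimes>\<^bsub>G\<^esub> nf i s = nf j t" for l i s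
  proof -
    obtain x b where "l = (x, b)" by (cases l)
    then consider "l = (SD_a, True)" | "l = (SD_a, False)" | "l = (SD_b, b)"
      by (cases x; cases b) auto
    then show ?thesis
      by cases (use letter A_nf B_nf in metis)+
  qed
  have normal_form: "\<exists>i s. word_class R u = nf i s" for u
  proof (induction u)
    case Nil
    have "word_class R [] = nf 0 False" by (simp add: nf_def word_class_Nil flip: G_def)
    then show ?case by blast
  next
    case (Cons l u)
    have "word_class R (l # u) = word_class R [l] \<otimes>\<^bsub>G\<^esub> word_class R u"
      by (simp add: G_def mult_word_class)
    then show ?case using Cons letters by metis
  qed
  have carrier_G: "\<exists>i s. x = nf i s" if "x \<in> carrier G" for x
    using that normal_form by (auto simp: G_def presented_group_def)

  define f where "f x = (case x of SD_a \<Rightarrow> (1 :: int, False) | SD_b \<Rightarrow> (0, True))" for x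
  have f_gens: "f SD_a = (1, False)" "f SD_b = (0, True)" by (simp_all add: f_def)
  have f: "f x \<in> carrier (SD_model n)" for x
    using assms by (auto simp: f_def split: SD_gen.splits)
  \<comment> \<open>Evaluates a whole block of letters \<open>a\<close> at once, so the relations
    can be checked with \<open>n\<close> symbolic.\<close>
  have eval_a: "eval_word (SD_model n) f (replicate k (SD_a, True) @ u)
      = (int k mod (4 * int n), False) \<otimes>\<^bsub>SD_model n\<^esub> eval_word (SD_model n) f u" for k u
  proof (induction k)
    case (Suc k)
    then show ?case
      by (cases "eval_word (SD_model n) f u") (simp add: f_gens mod_simps add.assoc)
  next
    case 0
    have "eval_word (SD_model n) f u \<in> carrier (SD_model n)"
      by (induction u) (auto simp: f simp del: semidirect_simps)
    then show ?case by auto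
  qed
  have "eval_word (SD_model n) f u = eval_word (SD_model n) f v" if "(u, v) \<in> R" for u v
    using that assms eval_a[of "4 * n" "[]"] eval_a[of "2 * n - 1" "[(SD_b, True)]"]
    by (auto simp: R_def f_gens numeral_2_eq_2 of_nat_diff)
  then obtain h where h: "h \<in> hom G (SD_model n)"
      and h_eval: "\<And>u. h (word_class R u) = eval_word (SD_model n) f u"
    using presented_group_universal[of "SD_model n" f R] H.is_group f unfolding G_def by blast
  interpret h: group_hom G "SD_model n" h
    by (unfold_locales) (rule h)
  have hA: "h A = (1, False)" and hB: "h B = (0, True)"
    using assms by (simp_all add: A_def B_def h_eval f_gens)
  \<comment> \<open>The image records exactly \<open>i\<close> modulo \<open>4 * n\<close> and
    \<open>s\<close>; together with \<open>nf_mod\<close> this gives injectivity.\<close>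
  have h_nf: "h (nf i s) = (int i mod (4 * int n), s)" for i s
    using assms by (simp add: nf_def h.hom_nat_pow hA hB semidirect_pow)
  have nf_mod: "nf i s = nf (i mod (4 * n)) s" for i s
    using G.pow_eq_pow_mod[OF AB(1) A_pow, of i] by (simp add: nf_def)
  have "inj_on h (carrier G)"
  proof (rule inj_onI)
    fix x y assume xy: "x \<in> carrier G" "y \<in> carrier G" "h x = h y"
    then obtain i s j t where nf: "x = nf i s" "y = nf j t" using carrier_G by metis
    then have "int (i mod (4 * n)) = int (j mod (4 * n))" "s = t"
      using xy(3) by (simp_all add: h_nf zmod_int)
    then have "i mod (4 * n) = j mod (4 * n)" "s = t" by simp_all
    then have "nf (i mod (4 * n)) s = nf (j mod (4 * n)) t" by simp
    then show "x = y" using nf nf_mod[of i s] nf_mod[of j t] by (simp only:)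
  qed
  moreover have "carrier (SD_model n) \<subseteq> h ` carrier G"
  proof
    fix y assume "y \<in> carrier (SD_model n)"
    then obtain i s where "y = (i, s)" "0 \<le> i" "i < 4 * int n" by auto
    then have "y = h (nf (nat i) s)" by (simp add: h_nf)
    then show "y \<in> h ` carrier G" by simp
  qed
  ultimately have "h \<in> iso G (SD_model n)"
    using h h.hom_closed by (auto simp: iso_def bij_betw_def simp del: semidirect_simps)
  then show "SD_group n \<cong> SD_model n"
    unfolding G_eq is_iso_def by blast
qed

section \<open>Explicit cycles for \<open>n = 1\<close> and \<open>n = 3\<close>\<close>

text \<open>A list of \<open>8 * n\<close> distinct elements exhausts the carrier by counting, so
  coverage follows from length and distinctness.\<close>

lemma hamiltonian_SD_modelI:
  assumes "n \<ge> 1" "distinct vs" "length vs = 8 * n"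
    and vs: "set vs \<subseteq> {0..<4 * int n} \<times> UNIV"
    and comm: "\<And>x y. (x, y) \<in> set (zip vs (rotate1 vs)) \<Longrightarrow>
      x \<noteq> y \<and> x \<otimes>\<^bsub>SD_model n\<^esub> y = y \<otimes>\<^bsub>SD_model n\<^esub> x"
  shows "hamiltonian (commuting_graph (SD_model n))"
proof -
  have "card (set vs) = card ({0..<4 * int n} \<times> (UNIV :: bool set))"
    using assms by (simp add: distinct_card card_cartesian_product)
  then have set_vs: "set vs = {0..<4 * int n} \<times> UNIV"
    using vs by (intro card_subset_eq) auto
  have "set (zip vs (rotate1 vs)) \<subseteq> parcs (commuting_graph (SD_model n))"
  proof (rule subrelI)
    fix x y assume xy: "(x, y) \<in> set (zip vs (rotate1 vs))"
    have "x \<in> set vs" "y \<in> set vs"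
      using set_zip_leftD[OF xy] set_zip_rightD[OF xy] by simp_all
    then show "(x, y) \<in> parcs (commuting_graph (SD_model n))"
      using comm[OF xy] set_vs by (simp add: commuting_graph_def)
  qed
  then show ?thesis
    unfolding hamiltonian_iff_list using assms set_vs
    by (intro exI[of _ vs]) (simp add: commuting_graph_def)
qed

lemma hamiltonian_SD_model_1: "hamiltonian (commuting_graph (SD_model 1))"
proof (rule hamiltonian_SD_modelI)
  \<comment> \<open>The multiplier \<open>2 * n - 1\<close> is 1 here, so all elements commute and
    any ordering works.\<close>
  define vs :: "(int \<times> bool) list" where
    "vs = [(0, False), (1, False), (2, False), (3, False),
       (0, True), (1, True), (2, True), (3, True)]"
  show "distinct vs" "length vs = 8 * 1" "set vs \<subseteq> {0..<4 * int 1} \<times> UNIV"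
    by (simp_all add: vs_def)
  have "\<forall>(x, y) \<in> set (zip vs (rotate1 vs)).
      x \<noteq> y \<and> x \<otimes>\<^bsub>SD_model 1\<^esub> y = y \<otimes>\<^bsub>SD_model 1\<^esub> x"
    by (simp add: vs_def)
  then show "x \<noteq> y \<and> x \<otimes>\<^bsub>SD_model 1\<^esub> y = y \<otimes>\<^bsub>SD_model 1\<^esub> x"
    if "(x, y) \<in> set (zip vs (rotate1 vs))" for x y
    using that by blast
qed simp

lemma hamiltonian_SD_model_3: "hamiltonian (commuting_graph (SD_model 3))"
proof (rule hamiltonian_SD_modelI)
  \<comment> \<open>The central elements have first component 0, 3, 6 or 9 and second component
    \<open>False\<close>. One of them opens each row group: first come the other powers of
    \<open>a\<close>, then the elements outside with first component congruent to 0, 1 and 2 modulo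
    3.\<close>
  define vs :: "(int \<times> bool) list" where
    "vs = [(0, False), (1, False), (2, False), (4, False), (5, False),
         (7, False), (8, False), (10, False), (11, False),
       (3, False), (0, True), (3, True), (6, True), (9, True),
       (6, False), (1, True), (4, True), (7, True), (10, True),
       (9, False), (2, True), (5, True), (8, True), (11, True)]"
  show "distinct vs" "length vs = 8 * 3" "set vs \<subseteq> {0..<4 * int 3} \<times> UNIV"
    by (simp_all add: vs_def)
  have "\<forall>(x, y) \<in> set (zip vs (rotate1 vs)).
      x \<noteq> y \<and> x \<otimes>\<^bsub>SD_model 3\<^esub> y = y \<otimes>\<^bsub>SD_model 3\<^esub> x"
    by (simp add: vs_def)
  then show "x \<noteq> y \<and> x \<otimes>\<^bsub>SD_model 3\<^esub> y = y \<otimes>\<^bsub>SD_model 3\<^esub> x"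
    if "(x, y) \<in> set (zip vs (rotate1 vs))" for x y
    using that by blast
qed simp

section \<open>Failure for all other \<open>n\<close>\<close>

text \<open>Commutation with an element outside the powers of \<open>a\<close> reduces to this
  divisibility. After cancelling 2, \<open>int n - 1\<close> is coprime to \<open>int n\<close>, and
  to \<open>2 * int n\<close> exactly when \<open>n\<close> is even.\<close>

lemma SD_dvd_center:
  fixes n :: nat and k :: int
  assumes "4 * int n dvd (2 * int n - 2) * k"
  shows "(if even n then 2 * int n else int n) dvd k"
proof -
  have "2 * (2 * int n) dvd 2 * ((int n - 1) * k)"
    using assms by (simp add: algebra_simps)
  then have dvd: "2 * int n dvd (int n - 1) * k"
    by (simp only: dvd_mult_cancel_left) simp
  show ?thesis
  proof (cases "even n")
    case True
    have "coprime (2 * int n) (int n - 1)"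
      using True by (simp add: coprime_commute)
    then show ?thesis
      using True dvd by (simp add: coprime_dvd_mult_right_iff)
  next
    case False
    have "int n dvd (int n - 1) * k" using dvd by (rule dvd_mult_right)
    moreover have "coprime (int n) (int n - 1)" by simp
    ultimately show ?thesis
      using False by (simp add: coprime_dvd_mult_right_iff)
  qed
qed

lemma not_hamiltonian_SD_model:
  assumes "n \<ge> 2" "n \<noteq> 3"
  shows "\<not> hamiltonian (commuting_graph (SD_model n))"
proof
  assume ham: "hamiltonian (commuting_graph (SD_model n))"
  define m where "m = (if even n then 2 * int n else int n)"
  define k :: int where "k = (if even n then 2 else 4)"
  define Z where "Z = (\<lambda>j. (m * j, False)) ` {0..<k}"
  \<comment> \<open>Component labels: \<open>None\<close> for powers of \<open>a\<close>, and the
    residue modulo \<open>m\<close> naming a coset of the center outside them.\<close>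
  define c where "c x = (if snd x then Some (fst x mod m) else None)" for x :: "int \<times> bool"
  have m: "m > 1" and mk: "m * k = 4 * int n"
    using assms by (auto simp: m_def k_def)
  have Z_iff: "(i, s) \<in> Z \<longleftrightarrow> \<not> s \<and> 0 \<le> i \<and> i < 4 * int n \<and> m dvd i" for i s
  proof
    assume "\<not> s \<and> 0 \<le> i \<and> i < 4 * int n \<and> m dvd i"
    then obtain j where j: "\<not> s" "i = m * j" "0 \<le> m * j" "m * j < m * k"
      unfolding mk by (auto elim: dvdE)
    then have "j \<in> {0..<k}" using m by (simp add: zero_le_mult_iff)
    then show "(i, s) \<in> Z" using j by (auto simp: Z_def)
  qed (use m in \<open>auto simp: Z_def simp flip: mk\<close>)
  have dvd: "m dvd k" if "4 * int n dvd (2 * int n - 2) * k" for k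
    using SD_dvd_center[OF that] by (simp add: m_def)
  let ?V = "pverts (commuting_graph (SD_model n))"
  have V: "?V = {0..<4 * int n} \<times> UNIV" by (simp add: commuting_graph_def)
  have "card (c ` (?V - Z)) \<le> card Z"
  proof (rule hamiltonian_card_classes_le[OF ham])
    show "finite Z" by (simp add: Z_def)
    have "(0, False) \<in> Z \<inter> ?V" using assms by (simp add: Z_iff V)
    then show "Z \<inter> ?V \<noteq> {}" by blast
  next
    fix x y
    assume arc: "(x, y) \<in> parcs (commuting_graph (SD_model n))" and notZ: "x \<notin> Z" "y \<notin> Z"
    obtain i s j t where xy: "x = (i, s)" "y = (j, t)" by (cases x; cases y)
    have ij: "0 \<le> i" "i < 4 * int n" "0 \<le> j" "j < 4 * int n"
      and comm: "4 * int n dvd (i + (if s then (2 * int n - 1) * j else j))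
        - (j + (if t then (2 * int n - 1) * i else i))"
      using arc unfolding mod_eq_dvd_iff[symmetric] by (auto simp: xy commuting_graph_def)
    consider "s" "t" | "s" "\<not> t" | "\<not> s" "t" | "\<not> s" "\<not> t" by blast
    then show "c x = c y"
    proof cases
      case 1
      then have "4 * int n dvd (2 * int n - 2) * (j - i)"
        using comm by (simp add: algebra_simps)
      then have "m dvd i - j" using dvd by (metis dvd_diff_commute)
      then show ?thesis using 1 by (simp add: c_def xy mod_eq_dvd_iff)
    next
      case 2
      then have "4 * int n dvd (2 * int n - 2) * j"
        using comm by (simp add: algebra_simps)
      \<comment> \<open>A power of \<open>a\<close> commuting with an element outside is central,
        contradicting \<open>notZ\<close>; the next case is symmetric.\<close>
      then show ?thesis using dvd 2 notZ ij by (auto simp: Z_iff xy)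
    next
      case 3
      then have "4 * int n dvd - ((2 * int n - 2) * i)"
        using comm by (simp add: algebra_simps)
      then have "4 * int n dvd (2 * int n - 2) * i" by (simp only: dvd_minus_iff)
      then show ?thesis using dvd 3 notZ ij by (auto simp: Z_iff xy)
    qed (simp add: c_def xy)
  qed
  \<comment> \<open>All \<open>m + 1\<close> labels occur: \<open>None\<close> at
    \<open>(1, False)\<close>, which is not central as \<open>m > 1\<close>, and
    \<open>Some i\<close> at \<open>(i, True)\<close>.\<close>
  moreover have "insert None (Some ` {0..<m}) \<subseteq> c ` (?V - Z)"
  proof -
    have mn: "m \<le> 4 * int n" by (simp add: m_def)
    have "None = c (1, False)" "(1, False) \<in> ?V - Z"
      using m assms by (auto simp: c_def V Z_iff)
    moreover have "Some i = c (i, True)" "(i, True) \<in> ?V - Z" if "i \<in> {0..<m}" for i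
      using that mn by (auto simp: c_def V Z_iff)
    ultimately show ?thesis by blast
  qed
  then have "card (insert None (Some ` {0..<m})) \<le> card (c ` (?V - Z))"
    by (intro card_mono) (simp_all add: V)
  moreover have "card (insert None (Some ` {0..<m})) = Suc (nat m)"
    by (simp add: card_image)
  moreover have "card Z \<le> nat k"
    unfolding Z_def using card_image_le[of "{0..<k}"] by simp
  ultimately have "m + 1 \<le> k" using m by linarith
  \<comment> \<open>For even \<open>n\<close> the bound reads \<open>2 * n + 1 \<le> 2\<close>; for
    odd \<open>n\<close> it reads \<open>n + 1 \<le> 4\<close>, leaving only the excluded value
    3.\<close>
  then show False using assms by (auto simp: m_def k_def split: if_splits elim: oddE)
qed

theorem theorem4p17:
  fixes n :: nat
  assumes "n \<ge> 1"
  shows "hamiltonian (commuting_graph (SD_group n)) \<longleftrightarrow> n \<in> {1, 3}"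
proof -
  have "hamiltonian (commuting_graph (SD_group n)) \<longleftrightarrow> hamiltonian (commuting_graph (SD_model n))"
    using SD_group_iso_model[OF assms] by (rule hamiltonian_commuting_graph_iso)
  moreover have "n = 1 \<or> n = 3 \<or> (n \<ge> 2 \<and> n \<noteq> 3)" using assms by linarith
  ultimately show ?thesis
    using hamiltonian_SD_model_1 hamiltonian_SD_model_3 not_hamiltonian_SD_model by auto
qed

end
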